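(* Let $\Gamma$ be a compact Lie group acting linearly on a finite-dimensional complex vector space $V$, let $m\ge2$, let $\sigma:\Gamma\to\mathbf{Z}_m$ be a group epimorphism, and let $H=\ker\sigma$. Let $\{u_1,\ldots,u_s\}$ be a Hilbert basis of the ring $\mathcal{P}(H)$. For each $j\in\{1,\ldots,m-1\}$, set $\alpha(j)=\sum_{i=1}^{s}\alpha_{ji}$, with $\alpha_{ji}\in\mathbf{N}$. Then the invariants $$R_0(u_1),\ R_0(u_2),\ \ldots,\ R_0(u_s),$$ $$R_1(u_1)^{\alpha_{11}}\cdots R_1(u_s)^{\alpha_{1s}}\cdots R_{m-1}(u_1)^{\alpha_{m-1,1}}\cdots R_{m-1}(u_s)^{\alpha_{m-1,s}},$$ such that $$\sum_{j=1}^{m-1} j\,\alpha(j)\equiv 0 \pmod m,$$ form a Hilbert basis of the ring $\mathcal{P}(\Gamma)$.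
   Context: $\mathbf{N}$ denotes the nonnegative integers. $\mathbf{Z}_m\subset\mathbf{C}^{*}$ denotes the multiplicative cyclic group of the $m$-th roots of unity, so $\sigma$ is regarded as a complex-valued function on $\Gamma$, and $\sigma^j(\gamma)=\sigma(\gamma)^j$. Polynomial functions on $V$ are complex-valued functions $V\to\mathbf{C}$ that are polynomial in the coordinates of $V$ and their complex conjugates (i.e. complex-valued polynomial functions on the underlying real vector space). For a subgroup $K\le\Gamma$, $\mathcal{P}(K)$ is the ring of polynomial functions $f:V\to\mathbf{C}$ with $f(\gamma x)=f(x)$ for all $\gamma\in K$, $x\in V$. A Hilbert basis of $\mathcal{P}(K)$ is a finite set of generators of $\mathcal{P}(K)$ as a ring, i.e. every element of $\mathcal{P}(K)$ is a polynomial, with complex coefficients, in the elements of that set. For $j\in\{0,\ldots,m-1\}$, the $\sigma^j$-relative Reynolds operator $R_j:\mathcal{P}(H)\to\mathcal{P}(H)$ is $$R_j(f)(x)=\frac1m\sum_{\gamma H}\overline{\sigma^j(\gamma)}\,f(\gamma x)=\frac1m\sum_{k=0}^{m-1}\overline{\sigma^{jk}(\delta)}\,f(\delta^kx),$$ where the first sum is over the left cosets $\gamma H$ of $H$ in $\Gamma$, the bar is complex conjugation, and $\delta\in\Gamma$ is an arbitrary but fixed element such that $\sigma(\delta)$ is a primitive $m$-th root of unity.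
   Formalization: The listed family is in general infinite, so it is not literally a (finite) Hilbert basis; what is proved is that the whole family generates P(Γ) and that R_0(u_1),…,R_0(u_s) with finitely many of the admissible products form a Hilbert basis of P(Γ). *)

theory Defs
  imports
    "HOL-Analysis.Analysis"
    "HOL-Algebra.Left_Coset"
    "HOL-Algebra.Group_Action"
    "HOL-Number_Theory.Cong"
begin

section \<open>Compact Lie groups\<close>

text \<open>
  \<^term>\<open>Euclidean_space n\<close> is the subspace of \<^typ>\<open>nat \<Rightarrow> real\<close> of the points whose coordinates
  vanish from index n on. It is used instead of a type of class
  \<^class>\<open>euclidean_space\<close> because the latter has positive dimension, whereas finite groups are
  Lie groups of dimension 0.
\<close>

definition partial_deriv :: "nat \<Rightarrow> ((nat \<Rightarrow> real) \<Rightarrow> real) \<Rightarrow> (nat \<Rightarrow> real) \<Rightarrow> real" where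
  "partial_deriv i f x = deriv (\<lambda>t. f (x(i := t))) (x i)"

text \<open>
  \<open>Ck_on k n S f\<close>, for S open in \<^term>\<open>Euclidean_space n\<close>: all iterated partial derivatives of f
  of order at most k exist and are continuous on S.
\<close>

primrec Ck_on :: "nat \<Rightarrow> nat \<Rightarrow> (nat \<Rightarrow> real) set \<Rightarrow> ((nat \<Rightarrow> real) \<Rightarrow> real) \<Rightarrow> bool" where
  "Ck_on 0 n S f \<longleftrightarrow> continuous_map (subtopology (Euclidean_space n) S) euclideanreal f"
| "Ck_on (Suc k) n S f \<longleftrightarrow>
     continuous_map (subtopology (Euclidean_space n) S) euclideanreal f \<and>
     (\<forall>i<n. (\<forall>x\<in>S. (\<lambda>t. f (x(i := t))) field_differentiable (at (x i))) \<and>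
            Ck_on k n S (partial_deriv i f))"

definition smooth_map_on ::
  "nat \<Rightarrow> nat \<Rightarrow> (nat \<Rightarrow> real) set \<Rightarrow> ((nat \<Rightarrow> real) \<Rightarrow> (nat \<Rightarrow> real)) \<Rightarrow> bool" where
  "smooth_map_on n p S F \<longleftrightarrow> (\<forall>i<p. \<forall>k. Ck_on k n S (\<lambda>x. F x i))"

text \<open>A chart of a space T is a pair of its domain and its coordinate map.\<close>

definition chart_on ::
  "'g topology \<Rightarrow> nat \<Rightarrow> 'g set \<times> ('g \<Rightarrow> nat \<Rightarrow> real) \<Rightarrow> bool" where
  "chart_on T n = (\<lambda>(U, \<phi>).
     openin T U \<and> openin (Euclidean_space n) (\<phi> ` U) \<and>
     homeomorphic_map (subtopology T U) (subtopology (Euclidean_space n) (\<phi> ` U)) \<phi>)"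

definition smooth_atlas ::
  "'g topology \<Rightarrow> nat \<Rightarrow> ('g set \<times> ('g \<Rightarrow> nat \<Rightarrow> real)) set \<Rightarrow> bool" where
  "smooth_atlas T n \<A> \<longleftrightarrow>
     (\<forall>c\<in>\<A>. chart_on T n c) \<and> (\<Union>c\<in>\<A>. fst c) = topspace T \<and>
     (\<forall>(U, \<phi>)\<in>\<A>. \<forall>(W, \<psi>)\<in>\<A>.
        smooth_map_on n n (\<phi> ` (U \<inter> W)) (\<lambda>x. \<psi> (inv_into U \<phi> x)))"

text \<open>
  In the smoothness condition on multiplication, a point of \<^term>\<open>Euclidean_space (n + n)\<close> is the
  concatenation of the coordinates of the two factors.
\<close>

definition lower_half :: "nat \<Rightarrow> (nat \<Rightarrow> real) \<Rightarrow> nat \<Rightarrow> real" where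
  "lower_half n z = (\<lambda>i. if i < n then z i else 0)"

definition upper_half :: "nat \<Rightarrow> (nat \<Rightarrow> real) \<Rightarrow> nat \<Rightarrow> real" where
  "upper_half n z = (\<lambda>i. if i < n then z (i + n) else 0)"

locale lie_group = group G
  for G :: "('g, 'b) monoid_scheme" (structure) +
  fixes T :: "'g topology"
    and n :: nat
    and \<A> :: "('g set \<times> ('g \<Rightarrow> nat \<Rightarrow> real)) set"
  assumes topspace_eq_carrier: "topspace T = carrier G"
    and hausdorff: "Hausdorff_space T"
    and second_countable: "second_countable T"
    and atlas: "smooth_atlas T n \<A>"
    and continuous_mult: "continuous_map (prod_topology T T) T (\<lambda>(x, y). x \<otimes> y)"
    and smooth_mult:
      "\<lbrakk>(U, \<phi>) \<in> \<A>; (W, \<psi>) \<in> \<A>; (X, \<xi>) \<in> \<A>\<rbrakk> \<Longrightarrow>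
         smooth_map_on (n + n) n
           {z \<in> topspace (Euclidean_space (n + n)).
              lower_half n z \<in> \<phi> ` U \<and> upper_half n z \<in> \<psi> ` W \<and>
              inv_into U \<phi> (lower_half n z) \<otimes> inv_into W \<psi> (upper_half n z) \<in> X}
           (\<lambda>z. \<xi> (inv_into U \<phi> (lower_half n z) \<otimes> inv_into W \<psi> (upper_half n z)))"
    and continuous_inverse: "continuous_map T T (\<lambda>x. inv x)"
    and smooth_inverse:
      "\<lbrakk>(U, \<phi>) \<in> \<A>; (W, \<psi>) \<in> \<A>\<rbrakk> \<Longrightarrow>
         smooth_map_on n n {x \<in> \<phi> ` U. inv (inv_into U \<phi> x) \<in> W}
           (\<lambda>x. \<psi> (inv (inv_into U \<phi> x)))"

locale compact_lie_group = lie_group +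
  assumes compact: "compact_space T"


section \<open>Linear actions and invariant polynomial functions\<close>

text \<open>
  Throughout, B is a basis of the complex vector space V with scalar multiplication \<open>scl\<close>, so that
  \<open>module.representation scl B x b\<close> is the b-coordinate of x. Continuity of the
  representation in GL(V) is continuity of its matrix entries.
\<close>

definition continuous_linear_action ::
  "('g, 'b) monoid_scheme \<Rightarrow> 'g topology \<Rightarrow> (complex \<Rightarrow> 'v \<Rightarrow> 'v) \<Rightarrow> 'v set \<Rightarrow>
   ('g \<Rightarrow> 'v \<Rightarrow> 'v::ab_group_add) \<Rightarrow> bool" where
  "continuous_linear_action G T scl B act \<longleftrightarrow>
     group_action G UNIV act \<and>
     (\<forall>\<gamma>\<in>carrier G. Vector_Spaces.linear scl scl (act \<gamma>)) \<and>
     (\<forall>b\<in>B. \<forall>c\<in>B. continuous_map T euclidean (\<lambda>\<gamma>. module.representation scl B (act \<gamma> b) c))"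

text \<open>
  The functions that are polynomials, with complex coefficients, in finitely many members of F.
\<close>

inductive_set poly_in :: "('v \<Rightarrow> complex) set \<Rightarrow> ('v \<Rightarrow> complex) set"
  for F :: "('v \<Rightarrow> complex) set" where
  const: "(\<lambda>x. c) \<in> poly_in F"
| gen: "f \<in> F \<Longrightarrow> f \<in> poly_in F"
| add: "\<lbrakk>f \<in> poly_in F; g \<in> poly_in F\<rbrakk> \<Longrightarrow> (\<lambda>x. f x + g x) \<in> poly_in F"
| mult: "\<lbrakk>f \<in> poly_in F; g \<in> poly_in F\<rbrakk> \<Longrightarrow> (\<lambda>x. f x * g x) \<in> poly_in F"

definition polynomial_functions ::
  "(complex \<Rightarrow> 'v::ab_group_add \<Rightarrow> 'v) \<Rightarrow> 'v set \<Rightarrow> ('v \<Rightarrow> complex) set" where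
  "polynomial_functions scl B =
     poly_in ((\<lambda>b x. module.representation scl B x b) ` B \<union>
              (\<lambda>b x. cnj (module.representation scl B x b)) ` B)"

definition invariant_ring ::
  "(complex \<Rightarrow> 'v::ab_group_add \<Rightarrow> 'v) \<Rightarrow> 'v set \<Rightarrow> ('g \<Rightarrow> 'v \<Rightarrow> 'v) \<Rightarrow> 'g set \<Rightarrow>
   ('v \<Rightarrow> complex) set" where
  "invariant_ring scl B act K =
     {f \<in> polynomial_functions scl B. \<forall>\<gamma>\<in>K. \<forall>x. f (act \<gamma> x) = f x}"

definition generates_ring :: "('v \<Rightarrow> complex) set \<Rightarrow> ('v \<Rightarrow> complex) set \<Rightarrow> bool" where
  "generates_ring P S \<longleftrightarrow> S \<subseteq> P \<and> (\<forall>f\<in>P. f \<in> poly_in S)"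

definition hilbert_basis :: "('v \<Rightarrow> complex) set \<Rightarrow> ('v \<Rightarrow> complex) set \<Rightarrow> bool" where
  "hilbert_basis P S \<longleftrightarrow> finite S \<and> generates_ring P S"


section \<open>The relative Reynolds operators\<close>

definition roots_of_unity :: "nat \<Rightarrow> complex monoid" where
  "roots_of_unity m = \<lparr>carrier = {z. z ^ m = 1}, mult = (*), one = 1\<rparr>"

text \<open>
  The sum runs over the left cosets C of the kernel, each evaluated at an arbitrary
  representative; on functions invariant under the kernel the value does not
  depend on the representatives.
\<close>

definition reynolds ::
  "('g, 'b) monoid_scheme \<Rightarrow> ('g \<Rightarrow> 'v \<Rightarrow> 'v) \<Rightarrow> nat \<Rightarrow> ('g \<Rightarrow> complex) \<Rightarrow> nat \<Rightarrow>
   ('v \<Rightarrow> complex) \<Rightarrow> ('v \<Rightarrow> complex)" where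
  "reynolds G act m \<sigma> j f = (\<lambda>x.
     1 / of_nat m *
     (\<Sum>C \<in> lcosets\<^bsub>G\<^esub> (kernel G (roots_of_unity m) \<sigma>).
        let \<gamma> = (SOME \<gamma>. \<gamma> \<in> C) in cnj (\<sigma> \<gamma> ^ j) * f (act \<gamma> x)))"

lemma group_roots_of_unity:
  assumes "m > 0" shows "group (roots_of_unity m)"
proof (rule groupI)
  fix x assume "x \<in> carrier (roots_of_unity m)"
  then have "x ^ m = 1" by (simp add: roots_of_unity_def)
  moreover have "x \<noteq> 0" using calculation assms by (auto simp: power_0_left)
  ultimately have "inverse x \<in> carrier (roots_of_unity m)" "inverse x * x = 1"
    by (auto simp: roots_of_unity_def power_inverse)
  then show "\<exists>y\<in>carrier (roots_of_unity m). y \<otimes>\<^bsub>roots_of_unity m\<^esub> x = \<one>\<^bsub>roots_of_unity m\<^esub>"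
    by (auto simp: roots_of_unity_def)
qed (auto simp: roots_of_unity_def power_mult_distrib)

lemma reynolds_eq_power_sum:
  fixes \<sigma> :: "'g \<Rightarrow> complex" and act :: "'g \<Rightarrow> 'v \<Rightarrow> 'v"
  assumes act: "group_action G UNIV act"
    and m: "m > 0"
    and epi: "\<sigma> \<in> epi G (roots_of_unity m)"
    and \<delta>: "\<delta> \<in> carrier G"
    and prim: "\<And>k. \<lbrakk>0 < k; k < m\<rbrakk> \<Longrightarrow> \<sigma> \<delta> ^ k \<noteq> 1"
    and inv: "\<And>\<gamma> x. \<gamma> \<in> kernel G (roots_of_unity m) \<sigma> \<Longrightarrow> f (act \<gamma> x) = f x"
  shows "reynolds G act m \<sigma> j f x =
    1 / of_nat m * (\<Sum>k<m. cnj (\<sigma> \<delta> ^ (j * k)) * f (act (\<delta> [^]\<^bsub>G\<^esub> k) x))"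
proof -
  interpret group_action G UNIV act by fact
  interpret h: group_hom G "roots_of_unity m" \<sigma>
    using epi group_roots_of_unity[OF m] group_hom
    by (auto simp: group_hom_def group_hom_axioms_def epi_def)
  let ?H = "kernel G (roots_of_unity m) \<sigma>"
  let ?t = "\<lambda>\<gamma>. cnj (\<sigma> \<gamma> ^ j) * f (act \<gamma> x)"
  have sub: "subgroup ?H G" by (rule h.subgroup_kernel)
  have mult: "\<sigma> (a \<otimes>\<^bsub>G\<^esub> b) = \<sigma> a * \<sigma> b" if "a \<in> carrier G" "b \<in> carrier G" for a b
    using h.hom_mult[OF that] by (simp add: roots_of_unity_def)
  have inv_mult: "\<sigma> (inv\<^bsub>G\<^esub> a) * \<sigma> a = 1" if "a \<in> carrier G" for a
    using mult[of "inv\<^bsub>G\<^esub> a" a] that h.hom_one by (simp add: roots_of_unity_def)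
  have ker: "b \<in> ?H" if "b \<in> carrier G" "\<sigma> b = 1" for b
    using that by (simp add: kernel_def roots_of_unity_def)
  have t_cong: "?t a = ?t b" if ab: "a \<in> carrier G" "b \<in> carrier G" "\<sigma> a = \<sigma> b" for a b
  proof -
    let ?h = "a \<otimes>\<^bsub>G\<^esub> inv\<^bsub>G\<^esub> b"
    have "?h \<in> ?H"
      using ab inv_mult[of b] by (intro ker) (simp_all add: mult mult.commute del: h.hom_inv h.hom_mult)
    moreover have "act a x = act ?h (act b x)"
      using ab composition_rule[of x ?h b] by (simp add: h.G.m_assoc)
    ultimately show ?thesis using inv ab by simp
  qed
  have coset: "\<sigma> b = \<sigma> a" "b \<in> carrier G" if "a \<in> carrier G" "b \<in> a <#\<^bsub>G\<^esub> ?H" for a b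
    using that by (auto simp: l_coset_def kernel_def roots_of_unity_def mult simp del: h.hom_mult)
  have pow: "\<sigma> (\<delta> [^]\<^bsub>G\<^esub> k) = \<sigma> \<delta> ^ k" "\<delta> [^]\<^bsub>G\<^esub> k \<in> carrier G" for k :: nat
    using \<delta> h.hom_one by (induction k) (auto simp: mult roots_of_unity_def simp del: h.hom_mult)
  have root: "\<sigma> a ^ m = 1" if "a \<in> carrier G" for a
    using h.hom_closed[OF that] by (simp add: roots_of_unity_def)
  have nz: "\<sigma> \<delta> \<noteq> 0" using root[OF \<delta>] m by (auto simp: power_0_left)
  have inj_pow: "inj_on (\<lambda>k. \<sigma> \<delta> ^ k) {..<m}"
  proof (rule linorder_inj_onI)
    fix k l assume kl: "k < l" "k \<in> {..<m}" "l \<in> {..<m}"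
    then have "\<sigma> \<delta> ^ (l - k) \<noteq> 1" by (intro prim) auto
    then show "\<sigma> \<delta> ^ k \<noteq> \<sigma> \<delta> ^ l"
      using kl nz by (simp add: power_diff)
  qed auto
  have "(\<lambda>k. \<sigma> \<delta> ^ k) ` {..<m} = {z. z ^ m = 1}"
  proof (rule card_subset_eq)
    show "finite {z::complex. z ^ m = 1}" using m by (intro finite_roots_unity) auto
    show "(\<lambda>k. \<sigma> \<delta> ^ k) ` {..<m} \<subseteq> {z. z ^ m = 1}"
      using root[OF pow(2)] by (auto simp: pow)
    show "card ((\<lambda>k. \<sigma> \<delta> ^ k) ` {..<m}) = card {z::complex. z ^ m = 1}"
      using m inj_pow by (simp add: card_image card_roots_unity_eq)
  qed
  then have pow_ex: "\<exists>k<m. \<sigma> a = \<sigma> \<delta> ^ k" if "a \<in> carrier G" for a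
    using root[OF that] by blast
  have bij: "bij_betw (\<lambda>k. \<delta> [^]\<^bsub>G\<^esub> k <#\<^bsub>G\<^esub> ?H) {..<m} (lcosets\<^bsub>G\<^esub> ?H)"
  proof (rule bij_betw_imageI)
    show "inj_on (\<lambda>k. \<delta> [^]\<^bsub>G\<^esub> k <#\<^bsub>G\<^esub> ?H) {..<m}"
    proof (rule inj_onI)
      fix k l assume kl: "k \<in> {..<m}" "l \<in> {..<m}"
        "\<delta> [^]\<^bsub>G\<^esub> k <#\<^bsub>G\<^esub> ?H = \<delta> [^]\<^bsub>G\<^esub> l <#\<^bsub>G\<^esub> ?H"
      have "\<sigma> (\<delta> [^]\<^bsub>G\<^esub> k) = \<sigma> (\<delta> [^]\<^bsub>G\<^esub> l)"
        using h.G.lcos_self[OF pow(2) sub, of k] kl(3) coset(1)[OF pow(2)] by metis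
      then show "k = l" using kl inj_onD[OF inj_pow] by (simp add: pow)
    qed
    have "a <#\<^bsub>G\<^esub> ?H \<in> (\<lambda>k. \<delta> [^]\<^bsub>G\<^esub> k <#\<^bsub>G\<^esub> ?H) ` {..<m}" if a: "a \<in> carrier G" for a
    proof -
      obtain k where k: "k < m" "\<sigma> a = \<sigma> \<delta> ^ k" using pow_ex[OF a] by blast
      let ?h = "inv\<^bsub>G\<^esub> (\<delta> [^]\<^bsub>G\<^esub> k) \<otimes>\<^bsub>G\<^esub> a"
      have "?h \<in> ?H"
        using inv_mult[OF pow(2)[of k]] a pow k by (intro ker) (simp_all add: mult del: h.hom_inv h.hom_mult)
      moreover have "a = \<delta> [^]\<^bsub>G\<^esub> k \<otimes>\<^bsub>G\<^esub> ?h"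
        using a pow(2)[of k] by (simp flip: h.G.m_assoc)
      ultimately have "a \<in> \<delta> [^]\<^bsub>G\<^esub> k <#\<^bsub>G\<^esub> ?H"
        unfolding l_coset_def by blast
      then show ?thesis
        using h.G.l_repr_independence[OF _ pow(2) sub] k by blast
    qed
    then show "(\<lambda>k. \<delta> [^]\<^bsub>G\<^esub> k <#\<^bsub>G\<^esub> ?H) ` {..<m} = lcosets\<^bsub>G\<^esub> ?H"
      using pow(2) by (auto simp: LCOSETS_def)
  qed
  have "(\<Sum>C \<in> lcosets\<^bsub>G\<^esub> ?H. ?t (SOME \<gamma>. \<gamma> \<in> C)) =
        (\<Sum>k<m. ?t (SOME \<gamma>. \<gamma> \<in> \<delta> [^]\<^bsub>G\<^esub> k <#\<^bsub>G\<^esub> ?H))"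
    by (rule sum.reindex_bij_betw[OF bij, symmetric])
  also have "\<dots> = (\<Sum>k<m. ?t (\<delta> [^]\<^bsub>G\<^esub> k))"
  proof (rule sum.cong[OF refl])
    fix k :: nat
    have "(SOME \<gamma>. \<gamma> \<in> \<delta> [^]\<^bsub>G\<^esub> k <#\<^bsub>G\<^esub> ?H) \<in> \<delta> [^]\<^bsub>G\<^esub> k <#\<^bsub>G\<^esub> ?H"
      using h.G.lcos_self[OF pow(2)[of k] sub] by (rule someI)
    from coset[OF pow(2) this]
    show "?t (SOME \<gamma>. \<gamma> \<in> \<delta> [^]\<^bsub>G\<^esub> k <#\<^bsub>G\<^esub> ?H) = ?t (\<delta> [^]\<^bsub>G\<^esub> k)"
      using pow(2) by (intro t_cong)
  qed
  finally show ?thesis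
    by (simp add: reynolds_def Let_def pow mult.commute flip: power_mult)
qed

end

theory Submission
  imports Defs
begin

text \<open>
  Write \<open>u\<^sub>i\<close> as the sum of its relative Reynolds components \<open>R\<^sub>j(u\<^sub>i)\<close>, which transform under
  \<open>\<Gamma>\<close> by the character \<open>\<sigma>\<^sup>j\<close>. A \<open>\<Gamma>\<close>-invariant f is a polynomial in the \<open>u\<^sub>i\<close>, hence a combination of
  monomials in the \<open>R\<^sub>j(u\<^sub>i)\<close> with \<open>j > 0\<close>, whose coefficients are polynomials in the \<open>R\<^sub>0(u\<^sub>i)\<close>. Averaging
  over the powers of \<open>\<delta>\<close> fixes f and the monomials of weight divisible by m, and kills
  all others.
\<close>

section \<open>Polynomial functions\<close>

lemma poly_in_sum:
  assumes "\<And>i. i \<in> I \<Longrightarrow> f i \<in> poly_in F"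
  shows "(\<lambda>x. \<Sum>i\<in>I. f i x) \<in> poly_in F"
  using assms
  by (induction I rule: infinite_finite_induct) (auto intro: poly_in.intros)

lemma poly_in_prod:
  assumes "\<And>i. i \<in> I \<Longrightarrow> f i \<in> poly_in F"
  shows "(\<lambda>x. \<Prod>i\<in>I. f i x) \<in> poly_in F"
  using assms
  by (induction I rule: infinite_finite_induct) (auto intro: poly_in.intros)

lemma poly_in_power:
  assumes "f \<in> poly_in F"
  shows "(\<lambda>x. f x ^ k) \<in> poly_in F"
  using assms by (induction k) (auto intro: poly_in.intros)

lemma poly_in_cmult:
  assumes "f \<in> poly_in F"
  shows "(\<lambda>x. c * f x) \<in> poly_in F"
  using poly_in.mult[OF poly_in.const assms] .

lemma poly_in_compose:
  assumes "f \<in> poly_in F" and "\<And>g. g \<in> F \<Longrightarrow> (\<lambda>x. g (L x)) \<in> poly_in F'"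
  shows "(\<lambda>x. f (L x)) \<in> poly_in F'"
  using assms(1) by induction (auto intro: poly_in.intros assms(2))

lemma poly_in_mono:
  assumes "f \<in> poly_in F" and "F \<subseteq> F'"
  shows "f \<in> poly_in F'"
  using assms(1) by induction (use assms(2) in \<open>auto intro: poly_in.intros\<close>)

text \<open>In the basis \<open>B\<close> the map is a matrix: the coordinates of \<open>L x\<close>
  are linear combinations of those of \<open>x\<close>, and their conjugates are linear combinations
  of the conjugates. This is what makes the components \<open>R j (u i)\<close> polynomial.\<close>

lemma polynomial_functions_compose_linear:
  assumes V: "finite_dimensional_vector_space scl B"
    and L: "Vector_Spaces.linear scl scl L"
    and f: "f \<in> polynomial_functions scl B"
  shows "(\<lambda>x. f (L x)) \<in> polynomial_functions scl B"
proof -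
  interpret V: finite_dimensional_vector_space scl B by fact
  interpret L: Vector_Spaces.linear scl scl L by fact
  let ?r = "module.representation scl B"
  let ?F = "(\<lambda>b x. ?r x b) ` B \<union> (\<lambda>b x. cnj (?r x b)) ` B"
  have rep: "?r (L x) b = (\<Sum>c\<in>B. ?r (L c) b * ?r x c)" for x b
  proof -
    have "L x = L (\<Sum>c\<in>B. scl (?r x c) c)"
      by (simp add: V.sum_representation_eq V.independent_Basis V.finite_Basis V.span_Basis)
    also have "\<dots> = (\<Sum>c\<in>B. scl (?r x c) (L c))"
      by (simp add: L.sum L.scale)
    also have "?r \<dots> b = (\<Sum>c\<in>B. ?r (L c) b * ?r x c)"
      by (simp add: V.representation_sum V.representation_scale V.independent_Basis V.span_Basis mult.commute)
    finally show ?thesis .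
  qed
  have 1: "(\<lambda>x. ?r x c) \<in> poly_in ?F" "(\<lambda>x. cnj (?r x c)) \<in> poly_in ?F" if "c \<in> B" for c
    using that by (auto intro: poly_in.gen)
  have "(\<lambda>x. ?r (L x) b) \<in> poly_in ?F" for b
    by (subst rep) (intro poly_in_sum poly_in_cmult 1)
  moreover have "(\<lambda>x. cnj (?r (L x) b)) \<in> poly_in ?F" for b
    by (subst rep, subst cnj_sum, subst complex_cnj_mult) (intro poly_in_sum poly_in_cmult 1)
  ultimately have "(\<lambda>x. g (L x)) \<in> poly_in ?F" if "g \<in> ?F" for g
    using that by blast
  with f show ?thesis
    unfolding polynomial_functions_def by (rule poly_in_compose)
qed

section \<open>Relative Reynolds operators\<close>

lemma sum_powers_root_of_unity:
  fixes z :: complex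
  assumes "z ^ m = 1"
  shows "(\<Sum>k<m. z ^ k) = (if z = 1 then of_nat m else 0)"
  using assms by (simp add: geometric_sum)

text \<open>The image of \<delta> has exact order m, so the powers of \<delta> below m represent the
  cosets of the kernel, and averages over cosets become sums over \<open>k < m\<close>.\<close>

locale cyclic_quotient_action = group_action G UNIV act
  for G :: "('g, 'b) monoid_scheme" and act :: "'g \<Rightarrow> 'v \<Rightarrow> 'v" +
  fixes m :: nat and \<sigma> :: "'g \<Rightarrow> complex" and \<delta> :: 'g
  assumes m_pos: "m > 0"
    and epi: "\<sigma> \<in> epi G (roots_of_unity m)"
    and \<delta>_carrier: "\<delta> \<in> carrier G"
    and primitive: "\<And>k. \<lbrakk>0 < k; k < m\<rbrakk> \<Longrightarrow> \<sigma> \<delta> ^ k \<noteq> 1"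
begin

abbreviation "H \<equiv> kernel G (roots_of_unity m) \<sigma>"
abbreviation "\<omega> \<equiv> \<sigma> \<delta>"
abbreviation "R \<equiv> reynolds G act m \<sigma>"

text \<open>Invariance is kept apart from polynomiality because the identities for \<open>R\<close>
  hold for arbitrary \<open>H\<close>-invariant functions.\<close>

definition invariant :: "'g set \<Rightarrow> ('v \<Rightarrow> complex) \<Rightarrow> bool" where
  "invariant K f \<longleftrightarrow> (\<forall>\<gamma>\<in>K. \<forall>x. f (act \<gamma> x) = f x)"

sublocale \<sigma>: group_hom G "roots_of_unity m" \<sigma>
  using epi group_roots_of_unity[OF m_pos] group_hom
  by (auto simp: group_hom_def group_hom_axioms_def epi_def)

lemma \<sigma>_mult: "\<lbrakk>a \<in> carrier G; b \<in> carrier G\<rbrakk> \<Longrightarrow> \<sigma> (a \<otimes>\<^bsub>G\<^esub> b) = \<sigma> a * \<sigma> b"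
  using \<sigma>.hom_mult by (simp add: roots_of_unity_def)

lemma \<sigma>_root: "a \<in> carrier G \<Longrightarrow> \<sigma> a ^ m = 1"
  using \<sigma>.hom_closed[of a] by (simp add: roots_of_unity_def)

lemma \<sigma>_nonzero: "a \<in> carrier G \<Longrightarrow> \<sigma> a \<noteq> 0"
  using \<sigma>_root m_pos by (force simp: power_0_left)

lemma cnj_\<omega>: "cnj \<omega> = inverse \<omega>"
proof -
  have "norm \<omega> = 1"
    using \<sigma>_root[OF \<delta>_carrier] m_pos power_eq_1_iff by blast
  then have "\<omega> * cnj \<omega> = 1"
    by (simp add: complex_norm_square[symmetric])
  then show ?thesis
    by (metis inverse_unique)
qed

lemma \<delta>_power: "\<delta> [^]\<^bsub>G\<^esub> (k::nat) \<in> carrier G" "\<sigma> (\<delta> [^]\<^bsub>G\<^esub> k) = \<omega> ^ k"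
  using \<delta>_carrier \<sigma>.hom_one
  by (induction k) (auto simp: \<sigma>_mult roots_of_unity_def simp del: \<sigma>.hom_mult)

lemma act_mult: "\<lbrakk>a \<in> carrier G; b \<in> carrier G\<rbrakk> \<Longrightarrow> act (a \<otimes>\<^bsub>G\<^esub> b) x = act a (act b x)"
  using composition_rule[of x a b] by simp

lemma act_one: "act \<one>\<^bsub>G\<^esub> x = x"
  using id_eq_one by (metis UNIV_I restrict_apply')

text \<open>The factor split off is the one acting first, so replacing \<open>x\<close> by
  \<open>act \<delta> x\<close> in a sum over powers of \<delta> is a shift of the index.\<close>

lemma act_\<delta>_Suc: "act (\<delta> [^]\<^bsub>G\<^esub> Suc k) x = act (\<delta> [^]\<^bsub>G\<^esub> k) (act \<delta> x)"
  using \<delta>_power \<delta>_carrier by (simp add: act_mult)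

lemma \<omega>_power_eq_1_iff: "\<omega> ^ k = 1 \<longleftrightarrow> m dvd k"
proof -
  have "\<omega> ^ k = \<omega> ^ (m * (k div m) + k mod m)"
    by simp
  also have "\<dots> = \<omega> ^ (k mod m)"
    using \<sigma>_root[OF \<delta>_carrier] by (simp only: power_add power_mult) simp
  finally have *: "\<omega> ^ k = \<omega> ^ (k mod m)" .
  show ?thesis
    using primitive[of "k mod m"] m_pos unfolding * by (cases "k mod m = 0") (auto simp: dvd_eq_mod_eq_0)
qed

text \<open>By counting: the first m powers of \<omega> are distinct, and there are only m complex
  m-th roots of unity.\<close>

lemma \<sigma>_eq_power:
  assumes "a \<in> carrier G"
  obtains k where "k < m" "\<sigma> a = \<omega> ^ k"
proof -
  have inj: "inj_on (\<lambda>k. \<omega> ^ k) {..<m}"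
  proof (rule linorder_inj_onI)
    fix k l assume kl: "k < l" "k \<in> {..<m}" "l \<in> {..<m}"
    then have "\<omega> ^ (l - k) \<noteq> 1" by (intro primitive) auto
    then show "\<omega> ^ k \<noteq> \<omega> ^ l"
      using kl \<sigma>_nonzero[OF \<delta>_carrier] by (simp add: power_diff)
  qed auto
  have "(\<lambda>k. \<omega> ^ k) ` {..<m} = {z. z ^ m = 1}"
  proof (rule card_subset_eq)
    show "finite {z::complex. z ^ m = 1}" using m_pos by (intro finite_roots_unity) auto
    show "(\<lambda>k. \<omega> ^ k) ` {..<m} \<subseteq> {z. z ^ m = 1}"
      by (auto simp: \<omega>_power_eq_1_iff simp flip: power_mult)
    show "card ((\<lambda>k. \<omega> ^ k) ` {..<m}) = card {z::complex. z ^ m = 1}"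
      using m_pos inj by (simp add: card_image card_roots_unity_eq)
  qed
  with \<sigma>_root[OF assms] that show ?thesis by blast
qed

text \<open>Elements with the same image under \<sigma> differ by a left factor from the kernel,
  which \<open>f\<close> does not see.\<close>

lemma invariant_act_cong:
  assumes f: "invariant H f" and ab: "a \<in> carrier G" "b \<in> carrier G" "\<sigma> a = \<sigma> b"
  shows "f (act a x) = f (act b x)"
proof -
  let ?h = "a \<otimes>\<^bsub>G\<^esub> inv\<^bsub>G\<^esub> b"
  have h: "?h \<in> carrier G"
    using ab by simp
  have b: "?h \<otimes>\<^bsub>G\<^esub> b = a"
    using ab by (simp add: \<sigma>.G.m_assoc)
  have "\<sigma> ?h * \<sigma> b = \<sigma> b"
    using \<sigma>_mult[OF h ab(2)] ab(3) b by simp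
  then have "?h \<in> H"
    using \<sigma>_nonzero[OF ab(2)] h by (simp add: kernel_def roots_of_unity_def)
  then show ?thesis
    using f act_mult[OF h ab(2)] b by (simp add: invariant_def)
qed

lemma reynolds_eq:
  assumes "invariant H f"
  shows "R j f x = 1 / of_nat m * (\<Sum>k<m. inverse (\<omega> ^ (j * k)) * f (act (\<delta> [^]\<^bsub>G\<^esub> k) x))"
  using reynolds_eq_power_sum[OF group_action_axioms m_pos epi \<delta>_carrier primitive, of f j x] assms
  by (simp add: invariant_def cnj_\<omega> power_inverse)

text \<open>Acting by \<delta> shifts the summation index by one, which costs a factor
  \<open>\<omega> ^ j\<close>; the shift is cyclic because \<open>\<delta> ^ m\<close> lies in
  \<open>H\<close>.\<close>

lemma reynolds_\<delta>:
  assumes f: "invariant H f"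
  shows "R j f (act \<delta> x) = \<omega> ^ j * R j f x"
proof -
  let ?t = "\<lambda>k. inverse (\<omega> ^ (j * k)) * f (act (\<delta> [^]\<^bsub>G\<^esub> k) x)"
  have "f (act (\<delta> [^]\<^bsub>G\<^esub> m) x) = f (act (\<delta> [^]\<^bsub>G\<^esub> (0::nat)) x)"
    using \<delta>_power \<sigma>_root[OF \<delta>_carrier] by (intro invariant_act_cong[OF f]) (auto simp: roots_of_unity_def)
  moreover have "\<omega> ^ (j * m) = 1"
    by (simp add: \<omega>_power_eq_1_iff)
  ultimately have tm: "?t m = ?t 0"
    by (simp only: mult_0_right power_0)
  have "(\<Sum>k<m. inverse (\<omega> ^ (j * k)) * f (act (\<delta> [^]\<^bsub>G\<^esub> k) (act \<delta> x))) = (\<Sum>k<m. \<omega> ^ j * ?t (Suc k))"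
    unfolding act_\<delta>_Suc using \<sigma>_nonzero[OF \<delta>_carrier]
    by (intro sum.cong refl) (simp add: power_add field_simps)
  also have "\<dots> = \<omega> ^ j * (\<Sum>k<m. ?t (Suc k))"
    by (simp add: sum_distrib_left)
  \<comment> \<open>Splitting the sum over \<open>k < Suc m\<close> at either end leaves these two
    sums, so they differ only by \<open>?t m - ?t 0 = 0\<close>.\<close>
  also have "(\<Sum>k<m. ?t (Suc k)) = (\<Sum>k<m. ?t k)"
    using sum.lessThan_Suc_shift[of ?t m] sum.lessThan_Suc[of ?t m] tm by simp
  finally show ?thesis
    by (simp add: reynolds_eq[OF f])
qed

lemma reynolds_\<delta>_power:
  assumes "invariant H f"
  shows "R j f (act (\<delta> [^]\<^bsub>G\<^esub> k) x) = \<omega> ^ (j * k) * R j f x"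
proof (induction k arbitrary: x)
  case 0
  then show ?case by (simp add: act_one)
next
  case (Suc k)
  then show ?case
    unfolding act_\<delta>_Suc by (simp add: reynolds_\<delta>[OF assms] power_add)
qed

text \<open>Some power \<open>\<delta> ^ l\<close> has the same image as \<open>a\<close>. Then
  \<open>\<delta> ^ k\<close> times either of them has equal image too, so every term of the
  Reynolds sum agrees and the case of powers of \<delta> applies.\<close>

lemma reynolds_semi_invariant:
  assumes f: "invariant H f" and a: "a \<in> carrier G"
  shows "R j f (act a x) = \<sigma> a ^ j * R j f x"
proof -
  obtain l where l: "\<sigma> a = \<omega> ^ l"
    using \<sigma>_eq_power[OF a] by blast
  have "f (act (\<delta> [^]\<^bsub>G\<^esub> k) (act a x)) = f (act (\<delta> [^]\<^bsub>G\<^esub> k) (act (\<delta> [^]\<^bsub>G\<^esub> l) x))" for k :: nat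
    using invariant_act_cong[OF f, of "\<delta> [^]\<^bsub>G\<^esub> k \<otimes>\<^bsub>G\<^esub> a" "\<delta> [^]\<^bsub>G\<^esub> k \<otimes>\<^bsub>G\<^esub> \<delta> [^]\<^bsub>G\<^esub> l" x]
    using a l \<delta>_power by (simp add: act_mult \<sigma>_mult del: \<sigma>.hom_mult)
  then have "R j f (act a x) = R j f (act (\<delta> [^]\<^bsub>G\<^esub> l) x)"
    by (simp add: reynolds_eq[OF f])
  then show ?thesis
    by (simp add: reynolds_\<delta>_power[OF f] l mult.commute flip: power_mult)
qed

lemma invariant_reynolds_0: "invariant H f \<Longrightarrow> invariant (carrier G) (R 0 f)"
  using reynolds_semi_invariant[of f _ 0] by (simp add: invariant_def)

text \<open>Fourier inversion on the cyclic quotient: after exchanging the sums, the inner sum over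
  j runs over powers of a root of unity and vanishes except at \<open>k = 0\<close>.\<close>

lemma sum_reynolds:
  assumes f: "invariant H f"
  shows "(\<Sum>j<m. R j f x) = f x"
proof -
  have "(\<Sum>j<m. R j f x) =
      1 / of_nat m * (\<Sum>j<m. \<Sum>k<m. inverse (\<omega> ^ k) ^ j * f (act (\<delta> [^]\<^bsub>G\<^esub> k) x))"
    by (simp add: reynolds_eq[OF f] sum_divide_distrib power_inverse mult.commute[of _ "_ :: nat"] flip: power_mult)
  also have "(\<Sum>j<m. \<Sum>k<m. inverse (\<omega> ^ k) ^ j * f (act (\<delta> [^]\<^bsub>G\<^esub> k) x)) =
      (\<Sum>k<m. (\<Sum>j<m. inverse (\<omega> ^ k) ^ j) * f (act (\<delta> [^]\<^bsub>G\<^esub> k) x))"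
    by (subst sum.swap) (simp add: sum_distrib_right)
  also have "(\<Sum>k<m. (\<Sum>j<m. inverse (\<omega> ^ k) ^ j) * f (act (\<delta> [^]\<^bsub>G\<^esub> k) x)) =
      (\<Sum>k<m. if k = 0 then of_nat m * f (act (\<delta> [^]\<^bsub>G\<^esub> k) x) else 0)"
  proof (intro sum.cong refl)
    fix k assume "k \<in> {..<m}"
    then have "inverse (\<omega> ^ k) = 1 \<longleftrightarrow> k = 0"
      using primitive[of k] by (cases "k = 0") auto
    moreover have "inverse (\<omega> ^ k) ^ m = 1"
      using \<omega>_power_eq_1_iff[of "k * m"] by (simp add: power_inverse flip: power_mult)
    ultimately show "(\<Sum>j<m. inverse (\<omega> ^ k) ^ j) * f (act (\<delta> [^]\<^bsub>G\<^esub> k) x) =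
        (if k = 0 then of_nat m * f (act (\<delta> [^]\<^bsub>G\<^esub> k) x) else 0)"
      by (simp add: sum_powers_root_of_unity)
  qed
  also have "\<dots> = of_nat m * f x"
    using m_pos by (simp add: act_one)
  finally show ?thesis using m_pos by simp
qed

section \<open>Averaging over the powers of \<delta>\<close>

text \<open>On \<open>H\<close>-invariant functions this is the formula for \<open>R 0\<close>;
  fixing the representatives lets it be evaluated without an invariance hypothesis.\<close>

definition average :: "('v \<Rightarrow> complex) \<Rightarrow> 'v \<Rightarrow> complex" where
  "average f x = 1 / of_nat m * (\<Sum>k<m. f (act (\<delta> [^]\<^bsub>G\<^esub> k) x))"

lemma average_add: "average (\<lambda>x. f x + g x) = (\<lambda>x. average f x + average g x)"
  by (auto simp: average_def sum.distrib distrib_left)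

lemma average_invariant:
  assumes "invariant (carrier G) f"
  shows "average f = f"
  using assms \<delta>_power m_pos by (auto simp: average_def invariant_def)

text \<open>The average is \<open>f\<close> times the mean of the powers of
  \<open>\<omega> ^ w\<close>, which is 1 if \<open>\<omega> ^ w = 1\<close> and 0
  otherwise.\<close>

lemma average_semi_invariant:
  assumes "\<And>a x. a \<in> carrier G \<Longrightarrow> f (act a x) = \<sigma> a ^ w * f x"
  shows "average f = (\<lambda>x. if m dvd w then f x else 0)"
proof
  fix x
  have "average f x = 1 / of_nat m * ((\<Sum>k<m. (\<omega> ^ w) ^ k) * f x)"
    unfolding average_def sum_distrib_right
    by (simp add: assms \<delta>_power mult.commute[of _ "_ :: nat"] flip: power_mult)
  moreover have "(\<omega> ^ w) ^ m = 1"
    using \<omega>_power_eq_1_iff[of "w * m"] by (simp flip: power_mult)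
  ultimately show "average f x = (if m dvd w then f x else 0)"
    using m_pos by (simp add: sum_powers_root_of_unity \<omega>_power_eq_1_iff)
qed

end

section \<open>Monomials\<close>

text \<open>The index j starts at 1: the components with \<open>j = 0\<close> are already invariant
  and will serve as coefficients.\<close>

definition monomial :: "nat \<Rightarrow> nat \<Rightarrow> (nat \<Rightarrow> nat \<Rightarrow> 'v \<Rightarrow> complex) \<Rightarrow> (nat \<Rightarrow> nat \<Rightarrow> nat) \<Rightarrow> 'v \<Rightarrow> complex" where
  "monomial m s v \<alpha> x = (\<Prod>j=1..m-1. \<Prod>i=1..s. v j i x ^ \<alpha> j i)"

text \<open>The power of \<sigma> by which the monomial in the Reynolds components
  transforms.\<close>

definition weight :: "nat \<Rightarrow> nat \<Rightarrow> (nat \<Rightarrow> nat \<Rightarrow> nat) \<Rightarrow> nat" where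
  "weight m s \<alpha> = (\<Sum>j=1..m-1. j * (\<Sum>i=1..s. \<alpha> j i))"

text \<open>The bound on the exponents and their vanishing outside the index range make the set
  finite. The value m itself is allowed so that pure m-th powers are included.\<close>

definition reduced_admissible :: "nat \<Rightarrow> nat \<Rightarrow> (nat \<Rightarrow> nat \<Rightarrow> nat) set" where
  "reduced_admissible m s =
     {\<alpha>. m dvd weight m s \<alpha> \<and> (\<forall>j i. \<alpha> j i \<le> m) \<and> (\<forall>j i. \<alpha> j i \<noteq> 0 \<longrightarrow> j \<in> {1..m-1} \<and> i \<in> {1..s})}"

lemma finite_reduced_admissible: "finite (reduced_admissible m s)"
proof -
  let ?A = "{1..m-1} \<times> {1..s}"
  let ?S = "{f :: nat \<times> nat \<Rightarrow> nat. \<forall>p. (p \<in> ?A \<longrightarrow> f p \<in> {..m}) \<and> (p \<notin> ?A \<longrightarrow> f p = 0)}"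
  have "\<alpha> \<in> curry ` ?S" if "\<alpha> \<in> reduced_admissible m s" for \<alpha>
    using that by (intro image_eqI[of _ _ "case_prod \<alpha>"]) (auto simp: reduced_admissible_def)
  moreover have "finite ?S"
    by (intro finite_set_of_finite_funs) auto
  ultimately show ?thesis
    by (meson finite_imageI finite_subset subsetI)
qed

lemma monomial_add: "monomial m s v (\<lambda>j i. \<alpha> j i + \<beta> j i) x = monomial m s v \<alpha> x * monomial m s v \<beta> x"
  by (simp add: monomial_def power_add prod.distrib)

lemma monomial_single:
  assumes "j \<in> {1..m-1}" "i \<in> {1..s}"
  shows "monomial m s v (\<lambda>j' i'. if j' = j \<and> i' = i then k else 0) x = v j i x ^ k"
proof -
  have "(\<Prod>i'=1..s. v j' i' x ^ (if j' = j \<and> i' = i then k else 0)) = (if j' = j then v j i x ^ k else 1)" for j'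
    using assms(2) by (cases "j' = j") (simp_all add: if_distrib[of "\<lambda>n. _ ^ n"] prod.delta cong: if_cong)
  then show ?thesis
    using assms(1) by (simp add: monomial_def prod.delta)
qed

text \<open>
  Splitting each exponent as \<open>\<alpha> = \<alpha> mod m + m * (\<alpha> div m)\<close> leaves finitely many generators, since the
  m-th power of every factor is itself admissible.
\<close>

lemma admissible_monomial_in_poly_in:
  assumes "m > 0" and "m dvd weight m s \<alpha>"
  shows "monomial m s v \<alpha> \<in> poly_in (monomial m s v ` reduced_admissible m s)"
proof -
  let ?P = "poly_in (monomial m s v ` reduced_admissible m s)"
  define \<rho> where "\<rho> = (\<lambda>j i. if j \<in> {1..m-1} \<and> i \<in> {1..s} then \<alpha> j i mod m else 0)"
  \<comment> \<open>Reducing each exponent modulo m changes the weight only by multiples of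
    m.\<close>
  have "[weight m s \<rho> = weight m s \<alpha>] (mod m)"
    unfolding weight_def by (intro cong_sum cong_mult cong_refl) (auto simp: \<rho>_def cong_def)
  then have "m dvd weight m s \<rho>"
    using assms(2) by (simp add: cong_dvd_iff)
  moreover have "\<rho> j i \<le> m" for j i
    using assms(1) by (auto simp: \<rho>_def intro: less_imp_le)
  ultimately have "\<rho> \<in> reduced_admissible m s"
    by (auto simp: reduced_admissible_def \<rho>_def)
  then have \<rho>: "monomial m s v \<rho> \<in> ?P"
    by (auto intro: poly_in.gen)
  have pow: "(\<lambda>x. v j i x ^ m) \<in> ?P" if "j \<in> {1..m-1}" "i \<in> {1..s}" for j i
  proof -
    let ?e = "\<lambda>j' i'. if j' = j \<and> i' = i then m else 0"
    have "m dvd weight m s ?e"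
      unfolding weight_def by (intro dvd_sum dvd_mult) auto
    then have "?e \<in> reduced_admissible m s"
      using that by (auto simp: reduced_admissible_def)
    then have "monomial m s v ?e \<in> ?P"
      by (auto intro: poly_in.gen)
    moreover have "monomial m s v ?e = (\<lambda>x. v j i x ^ m)"
      by (rule ext) (rule monomial_single[OF that])
    ultimately show ?thesis by simp
  qed
  have "monomial m s v \<alpha> x =
      monomial m s v \<rho> x * (\<Prod>j=1..m-1. \<Prod>i=1..s. (v j i x ^ m) ^ (\<alpha> j i div m))" for x
    unfolding monomial_def prod.distrib[symmetric]
    by (intro prod.cong refl) (auto simp: \<rho>_def simp flip: power_mult power_add)
  then have eq: "monomial m s v \<alpha> =
      (\<lambda>x. monomial m s v \<rho> x * (\<Prod>j=1..m-1. \<Prod>i=1..s. (v j i x ^ m) ^ (\<alpha> j i div m)))" by auto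
  show ?thesis
    unfolding eq by (intro poly_in.mult[OF \<rho>] poly_in_prod poly_in_power pow)
qed

section \<open>Combinations of monomials with polynomial coefficients\<close>

text \<open>Induction on this set replaces explicit finite sums of coefficient times monomial, so
  additive operators such as \<open>average\<close> can be treated one term at a time.\<close>

inductive_set monomial_span ::
  "nat \<Rightarrow> nat \<Rightarrow> (nat \<Rightarrow> nat \<Rightarrow> 'v \<Rightarrow> complex) \<Rightarrow> ('v \<Rightarrow> complex) set \<Rightarrow> ('v \<Rightarrow> complex) set"
  for m s v F where
  monomial: "p \<in> poly_in F \<Longrightarrow> (\<lambda>x. p x * monomial m s v \<alpha> x) \<in> monomial_span m s v F"
| add: "\<lbrakk>f \<in> monomial_span m s v F; g \<in> monomial_span m s v F\<rbrakk> \<Longrightarrow>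
    (\<lambda>x. f x + g x) \<in> monomial_span m s v F"

lemma poly_in_subset_monomial_span:
  assumes "p \<in> poly_in F"
  shows "p \<in> monomial_span m s v F"
  \<comment> \<open>With all exponents zero the monomial is the constant 1.\<close>
  using monomial_span.monomial[OF assms, of m s v "\<lambda>_ _. 0"] by (simp add: monomial_def)

lemma monomial_span_sum:
  assumes "\<And>i. i \<in> I \<Longrightarrow> f i \<in> monomial_span m s v F"
  shows "(\<lambda>x. \<Sum>i\<in>I. f i x) \<in> monomial_span m s v F"
  using assms
  by (induction I rule: infinite_finite_induct)
    (auto intro: monomial_span.add poly_in_subset_monomial_span poly_in.const)

lemma monomial_span_mult:
  assumes "f \<in> monomial_span m s v F" and "g \<in> monomial_span m s v F"
  shows "(\<lambda>x. f x * g x) \<in> monomial_span m s v F"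
  using assms(1)
proof induction
  case f: (monomial p \<alpha>)
  show ?case
    using assms(2)
  proof induction
    case g: (monomial q \<beta>)
    have "(\<lambda>x. (p x * q x) * monomial m s v (\<lambda>j i. \<alpha> j i + \<beta> j i) x) \<in> monomial_span m s v F"
      by (intro monomial_span.monomial poly_in.mult f g)
    then show ?case by (simp add: monomial_add mult_ac)
  next
    case (add g1 g2)
    then show ?case using monomial_span.add by (fastforce simp: distrib_left)
  qed
next
  case (add f1 f2)
  then show ?case using monomial_span.add by (fastforce simp: distrib_right)
qed

text \<open>The span contains the constants and is closed under sums and products, so it contains
  every polynomial in its members.\<close>

lemma poly_in_monomial_span:
  assumes "f \<in> poly_in U" and "\<And>g. g \<in> U \<Longrightarrow> g \<in> monomial_span m s v F"
  shows "f \<in> monomial_span m s v F"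
  using assms(1)
  by induction (auto intro: assms(2) monomial_span.add monomial_span_mult
      poly_in_subset_monomial_span poly_in.const)

section \<open>Generation of the invariants by reduced monomials\<close>

context cyclic_quotient_action
begin

lemma invariant_poly_in:
  assumes "f \<in> poly_in F" and "\<And>g. g \<in> F \<Longrightarrow> invariant K g"
  shows "invariant K f"
  using assms(1) by induction (use assms(2) in \<open>auto simp: invariant_def\<close>)

text \<open>Each factor \<open>R j (u i)\<close> contributes \<sigma> to the power j, and these
  exponents add up to the weight.\<close>

lemma monomial_semi_invariant:
  assumes u: "\<forall>i\<in>{1..s}. invariant H (u i)" and a: "a \<in> carrier G"
  shows "monomial m s (\<lambda>j i. R j (u i)) \<alpha> (act a x) =
    \<sigma> a ^ weight m s \<alpha> * monomial m s (\<lambda>j i. R j (u i)) \<alpha> x"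
proof -
  have "monomial m s (\<lambda>j i. R j (u i)) \<alpha> (act a x) =
      (\<Prod>j=1..m-1. \<Prod>i=1..s. \<sigma> a ^ (j * \<alpha> j i) * R j (u i) x ^ \<alpha> j i)"
    unfolding monomial_def
    by (intro prod.cong refl) (simp add: reynolds_semi_invariant[OF _ a] u power_mult_distrib power_mult)
  then show ?thesis
    by (simp add: monomial_def weight_def prod.distrib power_sum sum_distrib_left)
qed

lemma invariant_monomial:
  assumes "\<forall>i\<in>{1..s}. invariant H (u i)" and "m dvd weight m s \<alpha>"
  shows "invariant (carrier G) (monomial m s (\<lambda>j i. R j (u i)) \<alpha>)"
proof -
  have "\<sigma> a ^ weight m s \<alpha> = 1" if "a \<in> carrier G" for a
    using assms(2) \<sigma>_root[OF that] by (auto simp: dvd_def power_mult)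
  then show ?thesis
    by (auto simp: invariant_def monomial_semi_invariant[OF assms(1)])
qed

theorem invariants_generated:
  fixes u :: "nat \<Rightarrow> 'v \<Rightarrow> complex"
  assumes u: "\<forall>i\<in>{1..s}. invariant H (u i)"
    and f: "f \<in> poly_in (u ` {1..s})" "invariant (carrier G) f"
  defines "v \<equiv> \<lambda>j i. R j (u i)"
  shows "f \<in> poly_in (v 0 ` {1..s} \<union> monomial m s v ` reduced_admissible m s)"
proof -
  let ?F = "v 0 ` {1..s} \<union> monomial m s v ` reduced_admissible m s"
  have F: "invariant (carrier G) g" if "g \<in> ?F" for g
    using that
  proof
    assume "g \<in> v 0 ` {1..s}"
    then show ?thesis
      using u invariant_reynolds_0 by (auto simp: v_def)
  next
    assume "g \<in> monomial m s v ` reduced_admissible m s"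
    then show ?thesis
      using invariant_monomial[OF u] by (auto simp: v_def reduced_admissible_def)
  qed
  have "f \<in> monomial_span m s v ?F"
    using f(1)
  proof (rule poly_in_monomial_span)
    fix g assume "g \<in> u ` {1..s}"
    then obtain i where i: "i \<in> {1..s}" "g = u i" by blast
    \<comment> \<open>For \<open>j = 0\<close> the component is itself in \<open>?F\<close>; for the
      others it is a monomial with a single exponent 1.\<close>
    have "v j i \<in> monomial_span m s v ?F" if "j < m" for j
    proof (cases "j = 0")
      case True
      then show ?thesis
        using i by (auto intro!: poly_in_subset_monomial_span poly_in.gen)
    next
      case False
      then have "j \<in> {1..m-1}" using that by auto
      from monomial_single[OF this i(1), of v 1] show ?thesis
        using monomial_span.monomial[OF poly_in.const, of 1 m s v "\<lambda>j' i'. if j' = j \<and> i' = i then 1 else 0"]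
        by simp
    qed
    then have "(\<lambda>x. \<Sum>j<m. v j i x) \<in> monomial_span m s v ?F"
      by (intro monomial_span_sum) auto
    then show "g \<in> monomial_span m s v ?F"
      using sum_reynolds[of "u i"] u i(1) by (simp add: i v_def)
  qed
  then have "average f \<in> poly_in ?F"
  proof induction
    case (monomial p \<alpha>)
    \<comment> \<open>Since \<open>?F\<close> consists of invariants, the coefficient
      \<open>p\<close> passes through the average, and the weight of \<alpha> alone decides whether
      the term survives.\<close>
    have "invariant (carrier G) p"
      using monomial F by (rule invariant_poly_in)
    then have "average (\<lambda>x. p x * monomial m s v \<alpha> x) =
        (\<lambda>x. if m dvd weight m s \<alpha> then p x * monomial m s v \<alpha> x else 0)"
      unfolding v_def
      by (intro average_semi_invariant) (simp add: monomial_semi_invariant[OF u] invariant_def)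
    moreover have "monomial m s v \<alpha> \<in> poly_in ?F" if "m dvd weight m s \<alpha>"
      using admissible_monomial_in_poly_in[OF m_pos that] by (rule poly_in_mono) blast
    ultimately show ?case
      using monomial by (cases "m dvd weight m s \<alpha>") (auto intro: poly_in.const poly_in.mult)
  next
    case (add f g)
    then show ?case by (simp add: average_add poly_in.add)
  qed
  then show ?thesis
    using average_invariant[OF f(2)] by simp
qed

end

section \<open>Application to compact Lie group actions\<close>

lemma cis_primitive_root:
  assumes "0 < k" "k < m"
  shows "cis (2 * pi / of_nat m) ^ k \<noteq> 1"
proof
  assume "cis (2 * pi / of_nat m) ^ k = 1"
  then have "cis (2 * pi * of_nat k / of_nat m) = cis (2 * pi * of_nat 0 / of_nat m)"
    by (simp add: Complex.DeMoivre mult_ac)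
  moreover have "inj_on (\<lambda>k. cis (2 * pi * real k / real m)) {..<m}"
    using Complex.bij_betw_roots_unity[of m] assms by (auto simp: bij_betw_def)
  ultimately show False
    using assms by (auto dest!: inj_onD[where x = k and y = 0])
qed

text \<open>The family of all admissible monomials may be infinite, so besides generation by the
  whole family a finite subset is exhibited that is a Hilbert basis.\<close>

theorem theorem3p5:
  fixes \<Gamma> :: "('g, 'b) monoid_scheme"
    and T :: "'g topology"
    and n :: nat
    and \<A> :: "('g set \<times> ('g \<Rightarrow> nat \<Rightarrow> real)) set"
    and scl :: "complex \<Rightarrow> 'v::ab_group_add \<Rightarrow> 'v"
    and B :: "'v set"
    and act :: "'g \<Rightarrow> 'v \<Rightarrow> 'v"
    and m s :: nat
    and H :: "'g set"
    and \<sigma> :: "'g \<Rightarrow> complex"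
    and u :: "nat \<Rightarrow> 'v \<Rightarrow> complex"
  assumes "compact_lie_group \<Gamma> T n \<A>"
    and "finite_dimensional_vector_space scl B"
    and "continuous_linear_action \<Gamma> T scl B act"
    and "m \<ge> 2"
    and "\<sigma> \<in> epi \<Gamma> (roots_of_unity m)"
    and "H = kernel \<Gamma> (roots_of_unity m) \<sigma>"
    and "hilbert_basis (invariant_ring scl B act H) (u ` {1..s})"
  shows
    "let R = reynolds \<Gamma> act m \<sigma>;
         monomial = (\<lambda>\<alpha> :: nat \<Rightarrow> nat \<Rightarrow> nat. \<lambda>x. \<Prod>j=1..m-1. \<Prod>i=1..s. R j (u i) x ^ \<alpha> j i);
         admissible = {\<alpha> :: nat \<Rightarrow> nat \<Rightarrow> nat. [(\<Sum>j=1..m-1. j * (\<Sum>i=1..s. \<alpha> j i)) = 0] (mod m)}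
     in generates_ring (invariant_ring scl B act (carrier \<Gamma>))
          ((\<lambda>i. R 0 (u i)) ` {1..s} \<union> monomial ` admissible) \<and>
        (\<exists>E. finite E \<and> E \<subseteq> admissible \<and>
           hilbert_basis (invariant_ring scl B act (carrier \<Gamma>))
             ((\<lambda>i. R 0 (u i)) ` {1..s} \<union> monomial ` E))"
proof -
  interpret compact_lie_group \<Gamma> T n \<A> by fact
  note V = assms(2)
  have m: "m > 0" using \<open>m \<ge> 2\<close> by simp
  have action: "group_action \<Gamma> UNIV act"
    and lin: "\<And>\<gamma>. \<gamma> \<in> carrier \<Gamma> \<Longrightarrow> Vector_Spaces.linear scl scl (act \<gamma>)"
    using assms(3) by (auto simp: continuous_linear_action_def)
  \<comment> \<open>Surjectivity of \<sigma> yields \<delta> as a preimage of the standard primitive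
    root.\<close>
  have "cis (2 * pi / of_nat m) ^ m = 1"
    using m by (simp add: Complex.DeMoivre)
  then have "cis (2 * pi / of_nat m) \<in> \<sigma> ` carrier \<Gamma>"
    using assms(5) by (auto simp: epi_def roots_of_unity_def)
  then obtain \<delta> where \<delta>: "\<delta> \<in> carrier \<Gamma>" "\<sigma> \<delta> = cis (2 * pi / of_nat m)" by force
  interpret A: cyclic_quotient_action \<Gamma> act m \<sigma> \<delta>
    using action m assms(5) \<delta> cis_primitive_root
    by (simp add: cyclic_quotient_action_def cyclic_quotient_action_axioms_def)
  define v where "v = (\<lambda>j i. reynolds \<Gamma> act m \<sigma> j (u i))"
  define S where "S = v 0 ` {1..s} \<union> monomial m s v ` {\<alpha>. m dvd weight m s \<alpha>}"
  let ?P = "invariant_ring scl B act (carrier \<Gamma>)"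
  let ?E = "reduced_admissible m s"
  have u: "u i \<in> polynomial_functions scl B" "A.invariant H (u i)" if "i \<in> {1..s}" for i
  proof -
    have "u i \<in> invariant_ring scl B act H"
      using assms(7) that by (auto simp: hilbert_basis_def generates_ring_def)
    then show "u i \<in> polynomial_functions scl B" "A.invariant H (u i)"
      by (auto simp: invariant_ring_def A.invariant_def)
  qed
  then have uH: "\<forall>i\<in>{1..s}. A.invariant A.H (u i)"
    by (simp add: assms(6))
  have poly: "v j i \<in> polynomial_functions scl B" if "i \<in> {1..s}" for i j
  proof -
    \<comment> \<open>The Reynolds sum is a finite combination of compositions of \<open>u i\<close>
      with linear maps, hence polynomial.\<close>
    have "(\<lambda>x. 1 / of_nat m * (\<Sum>k<m. inverse (\<sigma> \<delta> ^ (j * k)) * u i (act (\<delta> [^]\<^bsub>\<Gamma>\<^esub> k) x)))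
        \<in> polynomial_functions scl B"
      using polynomial_functions_compose_linear[OF V lin[OF A.\<delta>_power(1)] u(1)[OF that]]
      unfolding polynomial_functions_def by (intro poly_in_cmult poly_in_sum)
    then show ?thesis
      by (simp add: v_def A.reynolds_eq[OF bspec[OF uH that], abs_def])
  qed
  have mono: "monomial m s v \<alpha> \<in> polynomial_functions scl B" for \<alpha>
    using poly unfolding monomial_def[abs_def] polynomial_functions_def
    by (intro poly_in_prod poly_in_power)
  have sub: "S \<subseteq> ?P"
  proof
    fix g assume "g \<in> S"
    then have "g \<in> polynomial_functions scl B \<and> A.invariant (carrier \<Gamma>) g"
      unfolding S_def
    proof
      assume "g \<in> v 0 ` {1..s}"
      then show ?thesis
        using poly uH A.invariant_reynolds_0 by (auto simp: v_def)
    next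
      assume "g \<in> monomial m s v ` {\<alpha>. m dvd weight m s \<alpha>}"
      then show ?thesis
        using mono A.invariant_monomial[OF uH] by (auto simp: v_def)
    qed
    then show "g \<in> ?P"
      by (auto simp: invariant_ring_def A.invariant_def)
  qed
  have gen: "f \<in> poly_in (v 0 ` {1..s} \<union> monomial m s v ` ?E)" if "f \<in> ?P" for f
  proof -
    \<comment> \<open>Hence a \<Gamma>-invariant is \<open>H\<close>-invariant, and the given
      Hilbert basis expresses it in the \<open>u i\<close>.\<close>
    have "H \<subseteq> carrier \<Gamma>"
      unfolding assms(6) by (auto simp: kernel_def)
    then have "f \<in> invariant_ring scl B act H"
      using that by (auto simp: invariant_ring_def)
    then have "f \<in> poly_in (u ` {1..s})"
      using assms(7) by (simp add: hilbert_basis_def generates_ring_def)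
    moreover have "A.invariant (carrier \<Gamma>) f"
      using that by (simp add: invariant_ring_def A.invariant_def)
    ultimately show ?thesis
      unfolding v_def by (intro A.invariants_generated[OF uH])
  qed
  have E: "?E \<subseteq> {\<alpha>. m dvd weight m s \<alpha>}"
    by (auto simp: reduced_admissible_def)
  then have ES: "v 0 ` {1..s} \<union> monomial m s v ` ?E \<subseteq> S"
    by (auto simp: S_def)
  have "generates_ring ?P S"
    using sub gen poly_in_mono[OF _ ES] by (auto simp: generates_ring_def)
  moreover have "hilbert_basis ?P (v 0 ` {1..s} \<union> monomial m s v ` ?E)"
    using sub ES gen finite_reduced_admissible[of m s]
    by (auto simp: generates_ring_def hilbert_basis_def)
  ultimately show ?thesis
    using E finite_reduced_admissible[of m s]
    unfolding Let_def S_def v_def monomial_def[abs_def] weight_def cong_0_iff by blast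
qed

end
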